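(* Let $d \in \mathbb{N}$. Every graph $G$ admits a tree-decomposition such that: (i) every adhesion set has diameter at most $5d+2$ in $G$, and (ii) every bag is $(d,2d+1)$-inseparable in $G$.
   Context: Graphs are simple and undirected, and may be infinite and disconnected; $\mathbb{N}$ contains $0$. Distances: $d_G(u,v)$ is the distance of the vertices $u,v$ in $G$ ($\infty$ if they lie in different components). For $U,U' \subseteq V(G)$, $d_G(U,U')$ is the minimum distance in $G$ between an element of $U$ and an element of $U'$. The diameter of $U \subseteq V(G)$ in $G$, denoted $\mathrm{diam}_G(U)$, is the smallest $k \in \mathbb{N}\cup\{\infty\}$ such that $d_G(u,v)\le k$ for all $u,v \in U$ (distances are measured in $G$, not in $G[U]$). Inseparability: for $d, D \in \mathbb{N}$, a vertex set $U \subseteq V(G)$ is $(d,D)$-inseparable in $G$ if for every set $S \subseteq V(G)$ of diameter at most $d$ in $G$ and every two vertices $u,v \in U$, either at least one of $u,v$ has distance at most $D$ from $S$ in $G$, or $u,v$ lie in the same component of $G-S$. A tree-decomposition of a graph $G$ is a pair $(T,(V_t : t \in V(T)))$, where $T$ is a (possibly infinite) tree and $V_t \subseteq V(G)$ for each $t \in V(T)$, such that: (T1) $V(G)=\bigcup_{t \in V(T)} V_t$; (T2) for every edge $uv$ of $G$ there is $t \in V(T)$ with $u,v \in V_t$; (T3) for all $t_1,t_2,t_3 \in V(T)$, if $t_2$ lies on the path of $T$ between $t_1$ and $t_3$, then $V_{t_1}\cap V_{t_3} \subseteq V_{t_2}$. The sets $V_t$ are the bags, and the sets $V_e := V_s \cap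 V_t$ for edges $e = st$ of $T$ are the adhesion sets. *)

theory Defs
  imports Main "HOL-Library.Extended_Nat"
begin

record 'a graph =
  verts :: "'a set"
  edges :: "'a set set"

definition simple_graph :: "'a graph \<Rightarrow> bool" where
  "simple_graph G \<longleftrightarrow>
     (\<forall>e\<in>edges G. \<exists>u v. u \<in> verts G \<and> v \<in> verts G \<and> u \<noteq> v \<and> e = {u, v})"

definition is_walk :: "'a graph \<Rightarrow> 'a \<Rightarrow> 'a list \<Rightarrow> 'a \<Rightarrow> bool" where
  "is_walk G u p v \<longleftrightarrow> p \<noteq> [] \<and> hd p = u \<and> last p = v \<and> set p \<subseteq> verts G \<and>
     (\<forall>i. Suc i < length p \<longrightarrow> {p ! i, p ! Suc i} \<in> edges G)"

definition is_path :: "'a graph \<Rightarrow> 'a \<Rightarrow> 'a list \<Rightarrow> 'a \<Rightarrow> bool" where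
  "is_path G u p v \<longleftrightarrow> is_walk G u p v \<and> distinct p"

definition same_component :: "'a graph \<Rightarrow> 'a \<Rightarrow> 'a \<Rightarrow> bool" where
  "same_component G u v \<longleftrightarrow> (\<exists>p. is_walk G u p v)"

(* A walk with vertex list p has length p - 1 edges. The infimum of the empty
   set is \<infinity>, which covers vertices in different components. *)
definition gdist :: "'a graph \<Rightarrow> 'a \<Rightarrow> 'a \<Rightarrow> enat" where
  "gdist G u v = (INF p\<in>{p. is_walk G u p v}. enat (length p - 1))"

definition set_dist :: "'a graph \<Rightarrow> 'a set \<Rightarrow> 'a set \<Rightarrow> enat" where
  "set_dist G U U' = (INF u\<in>U. INF u'\<in>U'. gdist G u u')"

definition diam :: "'a graph \<Rightarrow> 'a set \<Rightarrow> enat" where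
  "diam G U = (LEAST k. \<forall>u\<in>U. \<forall>v\<in>U. gdist G u v \<le> k)"

definition del_verts :: "'a graph \<Rightarrow> 'a set \<Rightarrow> 'a graph" where
  "del_verts G S = \<lparr>verts = verts G - S, edges = {e \<in> edges G. e \<inter> S = {}}\<rparr>"

(* S may be empty: it has diameter 0 and infinite distance to every vertex, so
   an inseparable set always lies in a single component of G. *)
definition inseparable :: "'a graph \<Rightarrow> nat \<Rightarrow> nat \<Rightarrow> 'a set \<Rightarrow> bool" where
  "inseparable G d D U \<longleftrightarrow> U \<subseteq> verts G \<and>
     (\<forall>S. S \<subseteq> verts G \<longrightarrow> diam G S \<le> enat d \<longrightarrow>
        (\<forall>u\<in>U. \<forall>v\<in>U. set_dist G {u} S \<le> enat D \<or> set_dist G {v} S \<le> enat D \<or>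
           same_component (del_verts G S) u v))"

(* The closing edge of the cycle joins the last vertex of c to the first. *)
definition is_cycle :: "'a graph \<Rightarrow> 'a list \<Rightarrow> bool" where
  "is_cycle G c \<longleftrightarrow> length c \<ge> 3 \<and> is_path G (hd c) c (last c) \<and> {last c, hd c} \<in> edges G"

definition is_tree :: "'a graph \<Rightarrow> bool" where
  "is_tree T \<longleftrightarrow> simple_graph T \<and> verts T \<noteq> {} \<and>
     (\<forall>s\<in>verts T. \<forall>t\<in>verts T. same_component T s t) \<and> \<not> (\<exists>c. is_cycle T c)"

(* Only the values of B on verts T matter. *)
definition tree_decomposition :: "'a graph \<Rightarrow> 't graph \<Rightarrow> ('t \<Rightarrow> 'a set) \<Rightarrow> bool" where
  "tree_decomposition G T B \<longleftrightarrow> is_tree T \<and>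
     verts G = (\<Union>t\<in>verts T. B t) \<and>
     (\<forall>u v. {u, v} \<in> edges G \<longrightarrow> (\<exists>t\<in>verts T. u \<in> B t \<and> v \<in> B t)) \<and>
     (\<forall>t1 t2 t3 p. is_path T t1 p t3 \<and> t2 \<in> set p \<longrightarrow> B t1 \<inter> B t3 \<subseteq> B t2)"

(* HOL cannot quantify existentially over types, so the nodes of a decomposition
   tree need a concrete type. This one loses no generality: picking a node for
   each vertex and each edge of G and passing to the subtree they span yields a
   tree-decomposition with at most |V(G)| + \<aleph>\<^sub>0 nodes whose bags and adhesion sets
   are among the original ones. *)
type_synonym 'a node = "'a set set list"

end

theory Submission imports Defs "HOL-Library.Sublist" begin

text \<open>
  Choose a root in every component of the graph and let the depth of a vertex be its distance
  from its root. For every \<open>n\<close>, consider the components of the subgraph induced by the vertices of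
  depth at least \<open>n\<close>. Over all \<open>n\<close> these vertex sets form a laminar family, and a vertex \<open>x\<close> lies
  in only finitely many of them, one for each \<open>n \<le> depth x\<close>. The neighbourhood of such a set
  \<open>K\<close>, its boundary, lies in the layer just above \<open>K\<close>. The decomposition cuts off exactly those
  \<open>K\<close> that are narrow, meaning that the boundary has diameter at most \<open>3 d\<close>. As the family is
  laminar, no uncrossing is needed, and the adhesion sets are contained in the boundaries.

  That these cuts suffice is the content of \<open>narrow_comp_behind_separator\<close>. Let \<open>S\<close> have diameter
  at most \<open>d\<close> and separate \<open>u\<close> from its root, and let \<open>a\<close> be the least depth in \<open>S\<close>. A shortest
  path from the root to a vertex \<open>x\<close> on the side of \<open>u\<close> meets \<open>S\<close> at depth at least \<open>a\<close>, so if
  \<open>x\<close> has depth at most \<open>a + d\<close>, then it has distance at most \<open>d\<close> from \<open>S\<close>. Hence, if \<open>u\<close> is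
  further than \<open>d\<close> from \<open>S\<close>, then it is deeper than \<open>a + d\<close>, and the component \<open>K\<close> of the vertices
  deeper than \<open>a + d\<close> that contains \<open>u\<close> avoids \<open>S\<close>, because all of \<open>S\<close> has depth at most
  \<open>a + d\<close>. The boundary of \<open>K\<close> has depth \<open>a + d\<close> and thus lies in the ball of radius \<open>d\<close>
  around \<open>S\<close>. So \<open>K\<close> is narrow, and each vertex \<open>v\<close> that shares a bag with \<open>u\<close> lies in \<open>K\<close>, hence is
  connected to \<open>u\<close> outside \<open>S\<close>, or in the boundary of \<open>K\<close>, hence is close to \<open>S\<close>. Given two
  vertices that \<open>S\<close> separates, at least one of them is separated from the root.

  This argument gives adhesion sets of diameter at most \<open>3 d\<close> and \<open>(d, d)\<close>-inseparable bags, which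
  implies the bounds \<open>5 d + 2\<close> and \<open>2 d + 1\<close> of the theorem.

  The nodes of the tree are lists: the narrow sets containing a given vertex form a chain, and the
  node is this chain in decreasing order, or an initial segment of it. The parent of a node is
  obtained by dropping the last entry. Every vertex \<open>w\<close> has a home node, the chain of all narrow
  sets containing it, and the bags containing \<open>w\<close> are that of its home and those of some children
  of its home. So the nodes whose bags contain \<open>w\<close> form a star, which makes the path axiom of
  tree-decompositions easy to check.
\<close>

section \<open>Walks, components and distances\<close>

definition adj :: "'a graph \<Rightarrow> 'a \<Rightarrow> 'a \<Rightarrow> bool" where
  "adj G x y \<longleftrightarrow> x \<in> verts G \<and> y \<in> verts G \<and> {x, y} \<in> edges G"

lemma adj_sym: "adj G x y \<Longrightarrow> adj G y x"
  by (auto simp: adj_def insert_commute)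

lemma is_walk_successively:
  "is_walk G u p v \<longleftrightarrow> p \<noteq> [] \<and> hd p = u \<and> last p = v \<and> set p \<subseteq> verts G \<and>
     successively (\<lambda>x y. {x, y} \<in> edges G) p"
  by (auto simp: is_walk_def successively_conv_nth)

lemma is_walk_singleton: "is_walk G u [x] v \<longleftrightarrow> x = u \<and> x = v \<and> x \<in> verts G"
  by (auto simp: is_walk_successively)

lemma is_walk_Cons_Cons:
  "is_walk G u (x # y # p) v \<longleftrightarrow> x = u \<and> adj G x y \<and> is_walk G y (y # p) v"
  by (auto simp: is_walk_successively adj_def)

text \<open>
  Expressing walks by powers of the adjacency relation makes concatenation and reversal of walks
  instances of facts about relations.
\<close>
lemma walk_of_length_iff:
  "(\<exists>p. is_walk G u p v \<and> length p = Suc k) \<longleftrightarrow> u \<in> verts G \<and> (adj G ^^ k) u v"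
proof (induction k arbitrary: u)
  case 0
  show ?case
    by (auto simp: is_walk_singleton length_Suc_conv intro: exI[of _ "[v]"])
next
  case (Suc k)
  have "(\<exists>p. is_walk G u p v \<and> length p = Suc (Suc k)) \<longleftrightarrow>
      (\<exists>y p. adj G u y \<and> is_walk G y p v \<and> length p = Suc k)"
  proof
    assume "\<exists>p. is_walk G u p v \<and> length p = Suc (Suc k)"
    then obtain x y p where "is_walk G u (x # y # p) v" "length p = k"
      by (auto simp: length_Suc_conv)
    then show "\<exists>y p. adj G u y \<and> is_walk G y p v \<and> length p = Suc k"
      by (intro exI[of _ y] exI[of _ "y # p"]) (auto simp: is_walk_Cons_Cons)
  next
    assume "\<exists>y p. adj G u y \<and> is_walk G y p v \<and> length p = Suc k"
    then obtain y p where *: "adj G u y" "is_walk G y p v" "length p = Suc k" by blast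
    then obtain q where "p = y # q"
      by (cases p) (auto simp: is_walk_def)
    with * show "\<exists>p. is_walk G u p v \<and> length p = Suc (Suc k)"
      by (intro exI[of _ "u # p"]) (auto simp: is_walk_Cons_Cons)
  qed
  also have "\<dots> \<longleftrightarrow> (\<exists>y. adj G u y \<and> y \<in> verts G \<and> (adj G ^^ k) y v)"
    using Suc.IH by blast
  also have "\<dots> \<longleftrightarrow> u \<in> verts G \<and> (adj G ^^ Suc k) u v"
    using relpowp_Suc_D2[of k "adj G" u v] relpowp_Suc_I2[of "adj G" u _ k v]
    by (auto simp: adj_def simp del: relpowp.simps)
  finally show ?case .
qed

lemma same_component_iff: "same_component G u v \<longleftrightarrow> u \<in> verts G \<and> (adj G)\<^sup>*\<^sup>* u v"
proof -
  have "same_component G u v \<longleftrightarrow> (\<exists>k p. is_walk G u p v \<and> length p = Suc k)"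
    unfolding same_component_def is_walk_def by (metis Suc_pred length_greater_0_conv)
  also have "\<dots> \<longleftrightarrow> u \<in> verts G \<and> (\<exists>k. (adj G ^^ k) u v)"
    using walk_of_length_iff[of G u v] by auto
  finally show ?thesis by (simp add: rtranclp_is_Sup_relpowp)
qed

lemma gdist_le_iff:
  "gdist G u v \<le> enat n \<longleftrightarrow> (\<exists>k\<le>n. u \<in> verts G \<and> (adj G ^^ k) u v)"
proof
  assume le: "gdist G u v \<le> enat n"
  let ?L = "(\<lambda>p. enat (length p - 1)) ` {p. is_walk G u p v}"
  have "?L \<noteq> {}"
  proof
    assume "?L = {}"
    then have "gdist G u v = \<infinity>" by (simp only: gdist_def Inf_enat_def if_True simp_thms)
    then show False using le by simp
  qed
  then obtain x where "x \<in> ?L" by (meson ex_in_conv)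
  then have "Inf ?L \<in> ?L" by (rule wellorder_InfI)
  then obtain p where p: "is_walk G u p v" "gdist G u v = enat (length p - 1)"
    by (auto simp: gdist_def)
  moreover have "length p = Suc (length p - 1)"
    using p by (simp add: is_walk_def)
  ultimately have "u \<in> verts G \<and> (adj G ^^ (length p - 1)) u v"
    using walk_of_length_iff by metis
  then show "\<exists>k\<le>n. u \<in> verts G \<and> (adj G ^^ k) u v"
    using p le by auto
next
  assume "\<exists>k\<le>n. u \<in> verts G \<and> (adj G ^^ k) u v"
  then obtain k p where "k \<le> n" "is_walk G u p v" "length p = Suc k"
    using walk_of_length_iff by metis
  then show "gdist G u v \<le> enat n"
    unfolding gdist_def by (intro INF_lower2[of p]) auto
qed

text \<open>The least element exists because \<open>\<infinity>\<close> is an upper bound on all distances.\<close>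
lemma diam_le_iff: "diam G U \<le> k \<longleftrightarrow> (\<forall>u\<in>U. \<forall>v\<in>U. gdist G u v \<le> k)"
proof
  assume "diam G U \<le> k"
  moreover have "\<forall>u\<in>U. \<forall>v\<in>U. gdist G u v \<le> diam G U"
    unfolding diam_def by (rule LeastI[of _ \<infinity>]) simp
  ultimately show "\<forall>u\<in>U. \<forall>v\<in>U. gdist G u v \<le> k"
    by (meson order_trans)
qed (auto simp: diam_def intro: Least_le)

lemma relpow_adj_sym: "(adj G ^^ k) u v \<Longrightarrow> (adj G ^^ k) v u"
proof (induction k arbitrary: v)
  case (Suc k)
  then obtain w where "(adj G ^^ k) u w" "adj G w v" by auto
  then show ?case using Suc.IH by (meson adj_sym relpowp_Suc_I2)
qed auto

lemma relpow_adj_verts: "(adj G ^^ k) u v \<Longrightarrow> u \<in> verts G \<longleftrightarrow> v \<in> verts G"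
  by (cases k) (auto simp: adj_def elim: relpowp_E2 dest: relpowp_Suc_D2)

lemma gdist_refl_le: "u \<in> verts G \<Longrightarrow> gdist G u u \<le> enat n"
  unfolding gdist_le_iff by (intro exI[of _ 0]) auto

lemma gdist_sym_le: "gdist G u v \<le> enat n \<Longrightarrow> gdist G v u \<le> enat n"
  unfolding gdist_le_iff using relpow_adj_sym relpow_adj_verts by metis

lemma gdist_triangle_le:
  assumes "gdist G u v \<le> enat m" "gdist G v w \<le> enat n"
  shows "gdist G u w \<le> enat (m + n)"
proof -
  obtain k l where "k \<le> m" "l \<le> n" "u \<in> verts G" "(adj G ^^ k) u v" "(adj G ^^ l) v w"
    using assms by (auto simp: gdist_le_iff)
  then show ?thesis unfolding gdist_le_iff
    by (intro exI[of _ "k + l"]) (auto simp: relpowp_add)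
qed

lemma set_dist_singleton_le: "s \<in> S \<Longrightarrow> gdist G u s \<le> k \<Longrightarrow> set_dist G {u} S \<le> k"
  unfolding set_dist_def by (auto intro: INF_lower2)

lemma same_component_refl: "u \<in> verts G \<Longrightarrow> same_component G u u"
  by (simp add: same_component_iff)

lemma same_component_trans:
  "same_component G u v \<Longrightarrow> same_component G v w \<Longrightarrow> same_component G u w"
  by (auto simp: same_component_iff)

lemma same_component_sym: "same_component G u v \<Longrightarrow> same_component G v u"
  unfolding same_component_iff rtranclp_is_Sup_relpowp
  by (auto dest: relpow_adj_sym relpow_adj_verts)

lemma same_component_adj: "adj G u v \<Longrightarrow> same_component G u v"
  by (auto simp: same_component_iff adj_def)

lemma same_component_verts: "same_component G u v \<Longrightarrow> u \<in> verts G \<and> v \<in> verts G"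
  using same_component_sym same_component_iff by metis

lemma adj_del_verts: "adj (del_verts G S) x y \<longleftrightarrow> adj G x y \<and> x \<notin> S \<and> y \<notin> S"
  by (auto simp: adj_def del_verts_def)

lemma same_component_del_verts_mono:
  assumes "same_component (del_verts G S) x y" "S' \<inter> verts G \<subseteq> S"
  shows "same_component (del_verts G S') x y"
proof -
  have "adj (del_verts G S) \<le> adj (del_verts G S')"
    using assms(2) by (auto simp: adj_del_verts) (auto simp: adj_def)
  then show ?thesis
    using assms rtranclp_mono[of "adj (del_verts G S)" "adj (del_verts G S')"]
    by (auto simp: same_component_iff del_verts_def)
qed

lemma del_verts_empty: "del_verts G {} = G"
  by (simp add: del_verts_def)

section \<open>Prefix trees\<close>

definition prefix_tree :: "'b list set \<Rightarrow> 'b list graph" where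
  "prefix_tree N = \<lparr>verts = N, edges = {{s, s @ [z]} | s z. s \<in> N \<and> s @ [z] \<in> N}\<rparr>"

text \<open>
  The lists with prefix \<open>y\<close> are the subtree below \<open>y\<close>. Only the edge from \<open>y\<close> to its parent
  leaves it, so a walk with exactly one end in the subtree uses both ends of this edge.
\<close>
lemma walk_crosses_subtree_boundary:
  assumes "is_walk (prefix_tree N) s p t" "prefix y s \<noteq> prefix y t"
  shows "y \<in> set p \<and> butlast y \<in> set p"
  using assms
proof (induction p arbitrary: s rule: induct_list012)
  case 1
  then show ?case by (simp add: is_walk_def)
next
  case (2 x)
  then show ?case by (auto simp: is_walk_singleton)
next
  case (3 a b p)
  have ab: "s = a" "adj (prefix_tree N) a b" "is_walk (prefix_tree N) b (b # p) t"
    using "3.prems"(1) by (auto simp: is_walk_Cons_Cons)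
  show ?case
  proof (cases "prefix y a = prefix y b")
    case True
    then show ?thesis using "3.IH"(2)[OF ab(3)] "3.prems"(2) ab(1) by auto
  next
    case False
    obtain r z where "{a, b} = {r, r @ [z]}"
      using ab(2) by (auto simp: adj_def prefix_tree_def)
    then have "a = r \<and> b = r @ [z] \<or> a = r @ [z] \<and> b = r"
      by (auto simp: doubleton_eq_iff)
    with False have "y = r @ [z]" by auto
    then show ?thesis using \<open>a = r \<and> b = r @ [z] \<or> a = r @ [z] \<and> b = r\<close> by auto
  qed
qed

text \<open>
  A vertex \<open>x\<close> of the path outside the star around \<open>c\<close> is separated from \<open>s\<close> and \<open>t\<close> by an edge at
  \<open>c\<close>, except that \<open>x\<close> may lie below \<open>s\<close> or \<open>t\<close>. The path would have to cross the same tree edge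
  on the way to \<open>x\<close> and again on the way back, repeating a vertex.
\<close>
lemma path_between_star_nodes:
  assumes path: "is_path (prefix_tree N) s p t"
    and s: "s = c \<or> (\<exists>z. s = c @ [z])" and t: "t = c \<or> (\<exists>z. t = c @ [z])"
  shows "set p \<subseteq> {s, c, t}"
proof
  fix x assume "x \<in> set p"
  then obtain p1 p2 where p: "p = p1 @ x # p2" by (meson split_list)
  have walk: "is_walk (prefix_tree N) s (p1 @ x # p2) t" and dist: "distinct p"
    using path p by (auto simp: is_path_def)
  have w1: "is_walk (prefix_tree N) s (p1 @ [x]) x"
    using walk by (auto simp: is_walk_successively successively_append_iff hd_append split: if_splits)
  have w2: "is_walk (prefix_tree N) x (x # p2) t"
    using walk by (auto simp: is_walk_successively successively_append_iff)
  have hd: "s \<in> set (p1 @ [x])" and last: "t \<in> set (x # p2)"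
    using w1 w2 by (metis hd_in_set is_walk_def, metis is_walk_def last_in_set)
  \<comment> \<open>A vertex other than \<open>x\<close> cannot lie on both sides of \<open>x\<close> on the path.\<close>
  have once: "y = x" if "y \<in> set (p1 @ [x])" "y \<in> set (x # p2)" for y
    using that dist p by auto
  show "x \<in> {s, c, t}"
  proof (cases "prefix c x")
    case False
    have "prefix c s" "prefix c t" using s t by auto
    then have "c = x"
      using False once walk_crosses_subtree_boundary[OF w1, of c]
        walk_crosses_subtree_boundary[OF w2, of c] by blast
    then show ?thesis by simp
  next
    case True
    show ?thesis
    proof (rule ccontr)
      assume x: "x \<notin> {s, c, t}"
      \<comment> \<open>The child of \<open>c\<close> whose subtree contains \<open>x\<close>.\<close>
      obtain a where a: "prefix (c @ [a]) x"
        using True x by (metis append_Cons append_Nil append_assoc insertCI neq_Nil_conv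
            prefixE prefixI append_Nil2)
      let ?y = "c @ [a]"
      have ps: "prefix ?y s \<longleftrightarrow> s = ?y" and pt: "prefix ?y t \<longleftrightarrow> t = ?y"
        using s t by auto
      have c1: "?y \<in> set (p1 @ [x])" "s \<noteq> ?y \<Longrightarrow> c \<in> set (p1 @ [x])"
        using walk_crosses_subtree_boundary[OF w1, of ?y] a ps hd by auto
      have c2: "?y \<in> set (x # p2)" "t \<noteq> ?y \<Longrightarrow> c \<in> set (x # p2)"
        using walk_crosses_subtree_boundary[OF w2, of ?y] a pt last by auto
      have "?y = x" using once c1 c2 by blast
      then show False using once c1 c2 x by blast
    qed
  qed
qed

text \<open>
  Every list is joined to the empty list by its prefixes. There is no cycle, since removing an edge
  of a cycle leaves a path with at least three vertices between the ends of that edge, whereas these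
  ends lie in a common star and admit no such path.
\<close>
lemma is_tree_prefix_tree:
  assumes nil: "[] \<in> N" and closed: "\<And>s z. s @ [z] \<in> N \<Longrightarrow> s \<in> N"
  shows "is_tree (prefix_tree N)"
proof -
  let ?T = "prefix_tree N"
  have root: "same_component ?T [] t" if "t \<in> N" for t
    using that
  proof (induction t rule: rev_induct)
    case Nil
    then show ?case by (simp add: same_component_refl prefix_tree_def)
  next
    case (snoc z s)
    then have "adj ?T s (s @ [z])"
      using closed by (auto simp: adj_def prefix_tree_def)
    then show ?case
      using snoc closed same_component_trans same_component_adj by metis
  qed
  have "\<not> is_cycle ?T c" for c
  proof
    assume c: "is_cycle ?T c"
    then obtain s z where e: "{last c, hd c} = {s, s @ [z]}"
      by (auto simp: is_cycle_def prefix_tree_def)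
    then have "hd c = s \<or> hd c = s @ [z]" "last c = s \<or> last c = s @ [z]"
      by (auto simp: doubleton_eq_iff)
    then have "set c \<subseteq> {s, s @ [z]}"
      using path_between_star_nodes[of N "hd c" c "last c" s] c
      unfolding is_cycle_def by blast
    then have "card (set c) \<le> 2"
      using card_mono[of "{s, s @ [z]}" "set c"] by simp
    then show False
      using c by (simp add: is_cycle_def is_path_def distinct_card)
  qed
  moreover have "simple_graph ?T"
    by (fastforce simp: simple_graph_def prefix_tree_def)
  moreover have "same_component ?T s t" if "s \<in> N" "t \<in> N" for s t
    by (rule same_component_trans[OF same_component_sym[OF root[OF that(1)]] root[OF that(2)]])
  moreover have "verts ?T = N" by (simp add: prefix_tree_def)
  ultimately show ?thesis using nil by (auto simp: is_tree_def)
qed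


section \<open>Breadth-first layers\<close>

locale bfs_layering =
  fixes G :: "'a graph"
  assumes simple: "simple_graph G"
begin

text \<open>
  The choice depends only on the set of vertices connected to \<open>x\<close>, so that all vertices of a
  component get the same root.
\<close>
definition root :: "'a \<Rightarrow> 'a" where
  "root x = (SOME r. same_component G x r)"

definition depth :: "'a \<Rightarrow> nat" where
  "depth x = (LEAST k. (adj G ^^ k) (root x) x)"

definition deep_comp :: "nat \<Rightarrow> 'a \<Rightarrow> 'a set" where
  "deep_comp n x = {y. same_component (del_verts G {z. depth z < n}) x y}"

definition boundary :: "'a set \<Rightarrow> 'a set" where
  "boundary K = {w \<in> verts G - K. \<exists>k\<in>K. adj G k w}"

lemma edge_iff_adj: "{u, v} \<in> edges G \<longleftrightarrow> adj G u v"
  using simple by (fastforce simp: simple_graph_def adj_def doubleton_eq_iff)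

lemma root_cong:
  assumes "same_component G x y" shows "root x = root y"
proof -
  have "same_component G x r \<longleftrightarrow> same_component G y r" for r
    using same_component_trans[OF assms] same_component_trans[OF same_component_sym[OF assms]]
    by blast
  then show ?thesis by (simp add: root_def)
qed

lemma same_component_root: "x \<in> verts G \<Longrightarrow> same_component G x (root x)"
  unfolding root_def by (rule someI[of "same_component G x" x]) (rule same_component_refl)

lemma relpow_depth:
  assumes "x \<in> verts G" shows "(adj G ^^ depth x) (root x) x"
proof -
  have "\<exists>k. (adj G ^^ k) (root x) x"
    using same_component_sym[OF same_component_root[OF assms]]
    by (simp add: same_component_iff rtranclp_is_Sup_relpowp)
  then show ?thesis unfolding depth_def by (rule LeastI_ex)
qed

lemma depth_le: "(adj G ^^ k) (root x) x \<Longrightarrow> depth x \<le> k"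
  unfolding depth_def by (rule Least_le[of "\<lambda>k. (adj G ^^ k) (root x) x"])

lemma depth_adj: "adj G x y \<Longrightarrow> depth y \<le> Suc (depth x)"
  using relpow_depth[of x] root_cong[OF same_component_adj, of x y]
  by (intro depth_le) (auto simp: adj_def)

lemma depth_le_gdist:
  assumes "gdist G x y \<le> enat k" shows "depth y \<le> depth x + k"
proof -
  have "depth y \<le> depth x + l" if "(adj G ^^ l) x y" for l
    using that by (induction l arbitrary: y) (auto, fastforce dest: depth_adj)
  then show ?thesis using assms by (fastforce simp: gdist_le_iff)
qed

lemma parent_exists:
  assumes "x \<in> verts G" "x \<noteq> root x"
  obtains y where "adj G y x" "depth x = Suc (depth y)"
proof -
  obtain k where k: "depth x = Suc k"
    using relpow_depth[OF assms(1)] assms(2) by (cases "depth x") auto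
  then obtain y where y: "(adj G ^^ k) (root x) y" "adj G y x"
    using relpow_depth[OF assms(1)] by auto
  have "depth y \<le> k"
    using y root_cong[OF same_component_adj[OF y(2)]] by (intro depth_le) simp
  with y k depth_adj[OF y(2)] that show thesis by force
qed

lemma comp_verts: "y \<in> deep_comp n x \<Longrightarrow> y \<in> verts G \<and> n \<le> depth y"
  unfolding deep_comp_def using same_component_verts[of "del_verts G {z. depth z < n}" x y]
  by (auto simp: del_verts_def)

lemma self_in_comp: "x \<in> verts G \<Longrightarrow> n \<le> depth x \<Longrightarrow> x \<in> deep_comp n x"
  by (auto simp: deep_comp_def del_verts_def intro: same_component_refl)

lemma comp_cong: "y \<in> deep_comp n x \<Longrightarrow> deep_comp n y = deep_comp n x"
  unfolding deep_comp_def mem_Collect_eq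
  using same_component_trans[of "del_verts G {z. depth z < n}" x y]
    same_component_trans[OF same_component_sym, of "del_verts G {z. depth z < n}" x y]
  by blast

lemma comp_antimono: "m \<le> n \<Longrightarrow> deep_comp n x \<subseteq> deep_comp m x"
  using same_component_del_verts_mono[of G "{z. depth z < n}" x _ "{z. depth z < m}"]
  by (auto simp: deep_comp_def intro: order.strict_trans2)

lemma comp_adj: "y \<in> deep_comp n x \<Longrightarrow> adj G y z \<Longrightarrow> n \<le> depth z \<Longrightarrow> z \<in> deep_comp n x"
  using comp_verts[of y n x] same_component_adj[of "del_verts G {z. depth z < n}" y z]
    same_component_trans[of "del_verts G {z. depth z < n}" x y z]
  by (simp add: deep_comp_def adj_del_verts)

lemma comp_eq_if_adj:
  "adj G x y \<Longrightarrow> n \<le> depth x \<Longrightarrow> n \<le> depth y \<Longrightarrow> deep_comp n x = deep_comp n y"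
  using comp_cong[OF comp_adj[OF self_in_comp], of x n y] by (simp add: adj_def)

lemma comp_0: "deep_comp 0 x = {y. same_component G x y}"
  by (simp add: deep_comp_def del_verts_empty)

lemma boundary_comp_0: "boundary (deep_comp 0 x) = {}"
  using comp_adj[of _ 0 x] by (auto simp: boundary_def)

text \<open>
  A neighbour of the component at depth \<open>n\<close> or more would belong to it, and depths of adjacent
  vertices differ by at most one.
\<close>
lemma depth_boundary:
  assumes "w \<in> boundary (deep_comp n x)" shows "Suc (depth w) = n"
proof -
  obtain k where k: "k \<in> deep_comp n x" "adj G k w" "w \<notin> deep_comp n x"
    using assms by (auto simp: boundary_def)
  then have "depth w < n" using comp_adj by force
  moreover have "n \<le> Suc (depth w)"
    using comp_verts[OF k(1)] depth_adj[OF adj_sym[OF k(2)]] by linarith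
  ultimately show ?thesis by simp
qed

section \<open>Small separators yield layer components with small boundary\<close>

text \<open>
  Walk from \<open>x\<close> towards the root, always to a neighbour of smaller depth. As \<open>S\<close> separates \<open>x\<close> from
  the root, the walk hits \<open>S\<close>; each
  step costs one unit of distance and gains one unit of depth.
\<close>
lemma separator_on_geodesic:
  assumes "x \<in> verts G" "\<not> same_component (del_verts G S) (root x) x"
  shows "\<exists>s\<in>S. depth s \<le> depth x \<and> gdist G x s \<le> enat (depth x - depth s)"
  using assms
proof (induction "depth x" arbitrary: x rule: less_induct)
  case less
  show ?case
  proof (cases "x \<in> S")
    case True
    then show ?thesis using less.prems by (intro bexI[of _ x]) (auto intro: gdist_refl_le)
  next
    case False
    then have "x \<noteq> root x"
      using less.prems by (metis DiffI del_verts_def same_component_refl select_convs(1))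
    then obtain y where y: "adj G y x" "depth x = Suc (depth y)"
      using parent_exists less.prems(1) by blast
    have root: "root y = root x" by (rule root_cong[OF same_component_adj[OF y(1)]])
    have xy: "gdist G x y \<le> enat 1"
      using adj_sym[OF y(1)] less.prems(1) by (force simp: gdist_le_iff)
    show ?thesis
    proof (cases "y \<in> S")
      case True
      then show ?thesis using xy y(2) by (intro bexI[of _ y]) auto
    next
      case False
      then have "same_component (del_verts G S) y x"
        using y(1) \<open>x \<notin> S\<close> by (intro same_component_adj) (simp add: adj_del_verts)
      then have "\<not> same_component (del_verts G S) (root y) y"
        using less.prems(2) root same_component_trans by metis
      then obtain s where s: "s \<in> S" "depth s \<le> depth y" "gdist G y s \<le> enat (depth y - depth s)"
        using less.hyps[of y] y by (auto simp: adj_def)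
      have "gdist G x s \<le> enat (1 + (depth y - depth s))"
        by (rule gdist_triangle_le[OF xy s(3)])
      also have "1 + (depth y - depth s) = depth x - depth s" using s(2) y(2) by simp
      finally show ?thesis using s y(2) by (intro bexI[of _ s]) auto
    qed
  qed
qed

definition narrow :: "nat \<Rightarrow> 'a set \<Rightarrow> bool" where
  "narrow d K \<longleftrightarrow> diam G (boundary K) \<le> enat (3 * d)"

lemma narrow_comp_0: "narrow d (deep_comp 0 x)"
  by (simp add: narrow_def boundary_comp_0 diam_le_iff)

text \<open>
  A separator of small diameter may cross the layers arbitrarily, but it can be replaced by a layer:
  the component starts one step below the deepest level \<open>a + d\<close> that \<open>S\<close> can reach, where \<open>a\<close> is
  the least depth in \<open>S\<close>.
\<close>
lemma narrow_comp_behind_separator: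
  assumes u: "u \<in> verts G" and diam: "diam G S \<le> enat d"
    and sep: "\<not> same_component (del_verts G S) (root u) u"
    and far: "\<not> (\<exists>s\<in>S. gdist G u s \<le> enat d)"
  obtains n where "n \<le> depth u" "narrow d (deep_comp n u)"
    "\<And>x. x \<in> deep_comp n u \<Longrightarrow> same_component (del_verts G S) u x"
    "\<And>w. w \<in> boundary (deep_comp n u) \<Longrightarrow> \<exists>s\<in>S. gdist G w s \<le> enat d"
proof -
  let ?H = "del_verts G S"
  have "S \<noteq> {}" using separator_on_geodesic[OF u sep] by auto
  then obtain s0 where s0: "s0 \<in> S" "\<And>s. s \<in> S \<Longrightarrow> depth s0 \<le> depth s"
    using ex_has_least_nat[of "\<lambda>s. s \<in> S" _ depth] by blast
  define n where "n = Suc (depth s0 + d)"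
  have above: "depth s < n" if "s \<in> S" for s
    using diam s0(1) that depth_le_gdist[of s0 s d] by (auto simp: n_def diam_le_iff)
  \<comment> \<open>The shortest path from \<open>x\<close> to the root hits \<open>S\<close> within the \<open>d + 1\<close> levels from \<open>depth s0\<close> to
      \<open>depth s0 + d\<close>.\<close>
  have near: "\<exists>s\<in>S. gdist G x s \<le> enat d"
    if x: "same_component ?H u x" and "depth x < n" for x
  proof -
    have "same_component G u x"
      using same_component_del_verts_mono[OF x, of "{}"] by (simp add: del_verts_empty)
    then have "root x = root u" "x \<in> verts G"
      using root_cong same_component_verts by metis+
    moreover have "\<not> same_component ?H (root u) x"
      using x sep same_component_sym same_component_trans by metis
    ultimately obtain s where s: "s \<in> S" "gdist G x s \<le> enat (depth x - depth s)"
      using separator_on_geodesic[of x S] by auto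
    moreover have "depth x - depth s \<le> d"
      using s0(2)[OF s(1)] \<open>depth x < n\<close> by (simp add: n_def)
    ultimately show ?thesis by (meson enat_ord_simps(1) order_trans)
  qed
  have "u \<notin> S"
    using far gdist_refl_le[OF u] by auto
  then have uu: "same_component ?H u u"
    using u by (auto simp: del_verts_def intro: same_component_refl)
  have deep: "n \<le> depth u" using near[OF uu] far by linarith
  have behind: "same_component ?H u x" if "x \<in> deep_comp n u" for x
    using same_component_del_verts_mono[of G "{z. depth z < n}" u x S] that above
    by (auto simp: deep_comp_def)
  have bd: "\<exists>s\<in>S. gdist G w s \<le> enat d" if w: "w \<in> boundary (deep_comp n u)" for w
  proof (cases "w \<in> S")
    case True
    then show ?thesis using w by (intro bexI[of _ w]) (auto simp: boundary_def intro: gdist_refl_le)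
  next
    case False
    obtain k where k: "k \<in> deep_comp n u" "adj G k w" using w by (auto simp: boundary_def)
    have "k \<notin> S" using k(1) above comp_verts by fastforce
    then have "same_component ?H u w"
      using behind[OF k(1)] k(2) False same_component_trans same_component_adj
      by (metis adj_del_verts)
    then show ?thesis using near depth_boundary[OF w] by simp
  qed
  have "gdist G w w' \<le> enat (3 * d)"
    if w: "w \<in> boundary (deep_comp n u)" and w': "w' \<in> boundary (deep_comp n u)" for w w'
  proof -
    obtain s s' where s: "s \<in> S" "gdist G w s \<le> enat d" "s' \<in> S" "gdist G w' s' \<le> enat d"
      using bd[OF w] bd[OF w'] by blast
    have "gdist G s s' \<le> enat d" using diam s by (simp add: diam_le_iff)
    then have "gdist G w w' \<le> enat (d + d + d)"
      by (intro gdist_triangle_le[OF gdist_triangle_le[OF s(2)] gdist_sym_le[OF s(4)]])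
    moreover have "d + d + d = 3 * d" by simp
    ultimately show ?thesis by metis
  qed
  then have "narrow d (deep_comp n u)" by (simp add: narrow_def diam_le_iff)
  with deep behind bd that show thesis by blast
qed

section \<open>The tree-decomposition\<close>

text \<open>
  The list of the narrow components of levels \<open>0, \<dots>, n - 1\<close> that contain \<open>x\<close>, outermost first.
  The singletons around the components merely match the type of the nodes.
\<close>
primrec chain :: "nat \<Rightarrow> nat \<Rightarrow> 'a \<Rightarrow> 'a node" where
  "chain d 0 x = []"
| "chain d (Suc n) x =
     (if narrow d (deep_comp n x) then chain d n x @ [{deep_comp n x}] else chain d n x)"

definition home :: "nat \<Rightarrow> 'a \<Rightarrow> 'a node" where
  "home d x = chain d (Suc (depth x)) x"

text \<open>
  The bound on \<open>n\<close> excludes levels below \<open>x\<close>, where \<open>deep_comp n x\<close> is empty. The empty list is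
  added because the graph may have no vertices; its bag is empty, and the components of the graph
  hang below it.
\<close>
definition nodes :: "nat \<Rightarrow> 'a node set" where
  "nodes d = insert [] {chain d n x | n x. x \<in> verts G \<and> n \<le> Suc (depth x)}"

definition bag :: "nat \<Rightarrow> 'a node \<Rightarrow> 'a set" where
  "bag d t = {w \<in> verts G. home d w = t} \<union> (if t = [] then {} else boundary (the_elem (last t)))"

lemma chain_cong: "(\<And>m. m < n \<Longrightarrow> deep_comp m x = deep_comp m y) \<Longrightarrow> chain d n x = chain d n y"
  by (induction n) auto

lemma in_set_chain_iff: "X \<in> set (chain d n x) \<longleftrightarrow> (\<exists>m<n. narrow d (deep_comp m x) \<and> X = {deep_comp m x})"
  by (induction n) (auto simp: less_Suc_eq)

lemma chain_eq_snoc: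
  "chain d n x = t @ [X] \<Longrightarrow> \<exists>m<n. narrow d (deep_comp m x) \<and> t = chain d m x \<and> X = {deep_comp m x}"
  by (induction n) (auto simp: less_Suc_eq split: if_splits)

text \<open>
  The vertex \<open>w\<close> has depth \<open>m - 1\<close> and a neighbour in \<open>deep_comp m x\<close>, hence it shares with \<open>x\<close>
  the components of all levels below \<open>m\<close>, and these are all levels that contain \<open>w\<close>. This is why
  the bags containing \<open>w\<close> form a star.
\<close>
lemma home_boundary:
  assumes "w \<in> boundary (deep_comp m x)" shows "home d w = chain d m x"
proof -
  obtain k where k: "k \<in> deep_comp m x" "adj G k w" using assms by (auto simp: boundary_def)
  have m: "Suc (depth w) = m" by (rule depth_boundary[OF assms])
  have "deep_comp l w = deep_comp l x" if "l < m" for l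
  proof -
    have "k \<in> deep_comp l x" using comp_antimono[of l m x] k(1) that by auto
    then have "w \<in> deep_comp l x" using comp_adj[OF _ k(2)] that m by simp
    then show ?thesis by (rule comp_cong)
  qed
  then show ?thesis unfolding home_def m by (rule chain_cong)
qed

lemma snoc_in_nodesE:
  assumes "t @ [X] \<in> nodes d"
  obtains P where "X = {P}" "narrow d P" "t \<in> nodes d" "\<And>w. w \<in> boundary P \<Longrightarrow> home d w = t"
proof -
  obtain n x where x: "t @ [X] = chain d n x" "x \<in> verts G" "n \<le> Suc (depth x)"
    using assms by (auto simp: nodes_def)
  then obtain m where m: "m < n" "narrow d (deep_comp m x)" "t = chain d m x" "X = {deep_comp m x}"
    using chain_eq_snoc[OF x(1)[symmetric]] by blast
  have "m \<le> Suc (depth x)" using x(3) m(1) by simp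
  then have "t \<in> nodes d" unfolding nodes_def m(3) using x(2) by blast
  moreover have "home d w = t" if "w \<in> boundary (deep_comp m x)" for w
    using home_boundary[OF that] m(3) by simp
  ultimately show thesis using that[of "deep_comp m x"] m by blast
qed

lemma home_in_nodes: "x \<in> verts G \<Longrightarrow> home d x \<in> nodes d"
  unfolding home_def nodes_def by (intro insertI2 CollectI exI[of _ "Suc (depth x)"] exI[of _ x]) simp

lemma in_home_bag: "x \<in> verts G \<Longrightarrow> x \<in> bag d (home d x)"
  by (simp add: bag_def)

lemma in_bagE:
  assumes "w \<in> bag d t" "t \<in> nodes d"
  obtains "home d w = t"
  | P where "t = home d w @ [{P}]" "w \<in> boundary P" "narrow d P"
proof (cases "home d w = t")
  case False
  then have ne: "t \<noteq> []" and w: "w \<in> boundary (the_elem (last t))"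
    using assms(1) by (auto simp: bag_def split: if_splits)
  obtain s X where t: "t = s @ [X]" using ne by (metis rev_exhaust)
  have "s @ [X] \<in> nodes d" using assms(2) t by simp
  then obtain P where P: "X = {P}" "narrow d P" "\<And>w. w \<in> boundary P \<Longrightarrow> home d w = s"
    by (rule snoc_in_nodesE) (rule that)
  have "w \<in> boundary P" using w t P(1) by simp
  moreover from P(3)[OF this] have "t = home d w @ [{P}]" unfolding t P(1) by simp
  ultimately show thesis using P(2) by (intro that(2))
qed (rule that(1))

lemma bag_verts: "bag d t \<subseteq> verts G"
proof -
  have "boundary K \<subseteq> verts G" for K by (auto simp: boundary_def)
  then show ?thesis by (simp add: bag_def)
qed

text \<open>
  The ends of an edge lie in the same components up to the level of the upper end. So either they
  have the same home, or the home of the lower end extends that of the upper end by one component,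
  whose boundary contains the upper end.
\<close>
lemma edge_in_bag:
  assumes uv: "adj G u v" and le: "depth u \<le> depth v"
  shows "u \<in> bag d (home d v)"
proof (cases "depth u = depth v")
  case True
  then have "home d u = home d v"
    unfolding home_def True by (intro chain_cong comp_eq_if_adj[OF uv]) (use True in auto)
  then show ?thesis using in_home_bag[of u d] uv by (simp add: adj_def)
next
  case False
  then have v: "depth v = Suc (depth u)" using le depth_adj[OF uv] by simp
  have same: "home d u = chain d (depth v) v"
    unfolding home_def v by (intro chain_cong comp_eq_if_adj[OF uv]) (use v in auto)
  show ?thesis
  proof (cases "narrow d (deep_comp (depth v) v)")
    case True
    have "u \<notin> deep_comp (depth v) v" using comp_verts[of u "depth v" v] v by auto
    moreover have "v \<in> deep_comp (depth v) v" using self_in_comp uv by (auto simp: adj_def)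
    ultimately have "u \<in> boundary (deep_comp (depth v) v)"
      using adj_sym[OF uv] by (auto simp: boundary_def adj_def)
    then show ?thesis using True by (simp add: bag_def home_def)
  next
    case False
    then have "home d u = home d v" using same by (simp add: home_def)
    then show ?thesis using in_home_bag[of u d] uv by (simp add: adj_def)
  qed
qed

lemma tree_decomposition_bags: "tree_decomposition G (prefix_tree (nodes d)) (bag d)"
proof -
  let ?T = "prefix_tree (nodes d)"
  have verts: "verts ?T = nodes d" by (simp add: prefix_tree_def)
  have "[] \<in> nodes d" by (simp add: nodes_def)
  then have "is_tree ?T"
    by (rule is_tree_prefix_tree) (elim snoc_in_nodesE)
  moreover have "verts G = (\<Union>t\<in>verts ?T. bag d t)"
    unfolding verts
  proof
    show "verts G \<subseteq> (\<Union>t\<in>nodes d. bag d t)"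
      using in_home_bag[of _ d] home_in_nodes[of _ d] by (auto intro!: UN_I)
    show "(\<Union>t\<in>nodes d. bag d t) \<subseteq> verts G"
      using bag_verts[of d] by (rule UN_least)
  qed
  moreover have "\<exists>t\<in>verts ?T. u \<in> bag d t \<and> v \<in> bag d t" if "{u, v} \<in> edges G" for u v
  proof -
    have uv: "adj G u v" using that edge_iff_adj by simp
    have meet: "\<exists>t\<in>nodes d. x \<in> bag d t \<and> y \<in> bag d t"
      if "adj G x y" "depth x \<le> depth y" for x y
    proof -
      have "y \<in> verts G" using that(1) by (simp add: adj_def)
      then show ?thesis using edge_in_bag[OF that, of d] in_home_bag home_in_nodes by blast
    qed
    show ?thesis
    proof (cases "depth u \<le> depth v")
      case True
      then show ?thesis unfolding verts by (rule meet[OF uv])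
    next
      case False
      then have "depth v \<le> depth u" by simp
      from meet[OF adj_sym[OF uv] this] show ?thesis unfolding verts by blast
    qed
  qed
  moreover have "bag d t1 \<inter> bag d t3 \<subseteq> bag d t2"
    if path: "is_path ?T t1 p t3" "t2 \<in> set p" for t1 t2 t3 p
  proof
    fix w assume w: "w \<in> bag d t1 \<inter> bag d t3"
    have "p \<noteq> []" "hd p = t1" "last p = t3" "set p \<subseteq> nodes d"
      using path(1) verts by (simp_all add: is_path_def is_walk_def)
    then have t: "t1 \<in> nodes d" "t3 \<in> nodes d"
      using hd_in_set[of p] last_in_set[of p] by auto
    have star: "t = home d w \<or> (\<exists>z. t = home d w @ [z])" if "w \<in> bag d t" "t \<in> nodes d" for t
      using that by (elim in_bagE) auto
    have "set p \<subseteq> {t1, home d w, t3}"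
      by (rule path_between_star_nodes[OF path(1)]) (use star w t in auto)
    then have "t2 \<in> {t1, home d w, t3}" using path(2) by blast
    moreover have "w \<in> bag d (home d w)"
      using in_home_bag w bag_verts[of d t1] by blast
    ultimately show "w \<in> bag d t2" using w by blast
  qed
  ultimately show ?thesis
    unfolding tree_decomposition_def by (intro conjI allI impI) (assumption | elim conjE)+
qed

text \<open>
  A vertex in the bags of a node and its child has the parent node as its home or lies on the
  boundary of the component added by the child; two different children of its home are never
  adjacent.
\<close>
lemma diam_adhesion_le:
  assumes "{s, t} \<in> edges (prefix_tree (nodes d))"
  shows "diam G (bag d s \<inter> bag d t) \<le> enat (3 * d)"
proof -
  obtain r z where e: "{s, t} = {r, r @ [z]}" and r: "r \<in> nodes d" "r @ [z] \<in> nodes d"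
    using assms by (auto simp: prefix_tree_def)
  from r(2) obtain P where P: "z = {P}" "narrow d P" by (rule snoc_in_nodesE) (rule that)
  have "w \<in> boundary P" if "w \<in> bag d r" "w \<in> bag d (r @ [z])" for w
    using that(1) r(1)
  proof (cases rule: in_bagE)
    case 1
    with that(2) P show ?thesis by (auto simp: bag_def)
  next
    case (2 Q)
    from that(2) r(2) show ?thesis by (cases rule: in_bagE) (use 2 P in auto)
  qed
  moreover have "bag d s \<inter> bag d t = bag d r \<inter> bag d (r @ [z])"
    using e by (auto simp: doubleton_eq_iff)
  ultimately show ?thesis using P(2) by (auto simp: narrow_def diam_le_iff)
qed

text \<open>
  The narrow component \<open>deep_comp n u\<close> is an entry of every node whose bag contains \<open>u\<close>. A vertex
  \<open>v\<close> of such a bag lies in all entries of the node, except that it may only lie on the boundary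
  of the last one.
\<close>
lemma bag_within_closed_comp:
  assumes t: "t \<in> nodes d" and u: "u \<in> bag d t" and v: "v \<in> bag d t"
    and n: "n \<le> depth u" "narrow d (deep_comp n u)"
  shows "v \<in> deep_comp n u \<union> boundary (deep_comp n u)"
proof -
  let ?K = "deep_comp n u"
  have "{?K} \<in> set (home d u)"
    unfolding home_def in_set_chain_iff using n by (intro exI[of _ n]) simp
  then have K: "{?K} \<in> set t" using u t by (elim in_bagE) auto
  have home: "v \<in> ?K" if "{?K} \<in> set (home d v)"
  proof -
    obtain m where "m \<le> depth v" "?K = deep_comp m v"
      using \<open>{?K} \<in> set (home d v)\<close> 
      by (auto simp: home_def in_set_chain_iff less_Suc_eq_le simp del: chain.simps)
    then show ?thesis using self_in_comp v bag_verts by blast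
  qed
  from v t show ?thesis
    by (cases rule: in_bagE) (use K home in auto)
qed

text \<open>
  Two vertices of a bag lie in the same component of \<open>G\<close>, as components of \<open>G\<close> are narrow with empty
  boundary. So they have a common root, and a set that separates them separates one of them from it.
\<close>
lemma bag_inseparable:
  assumes t: "t \<in> nodes d"
  shows "inseparable G d d (bag d t)"
proof -
  have one_side: "set_dist G {u} S \<le> enat d \<or> set_dist G {v} S \<le> enat d \<or>
      same_component (del_verts G S) u v"
    if diam: "diam G S \<le> enat d" and u: "u \<in> bag d t" and v: "v \<in> bag d t"
      and sep: "\<not> same_component (del_verts G S) (root u) u" for S u v
  proof (cases "\<exists>s\<in>S. gdist G u s \<le> enat d")
    case True
    then obtain s where "s \<in> S" "gdist G u s \<le> enat d" by blast
    then have "set_dist G {u} S \<le> enat d" by (rule set_dist_singleton_le)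
    then show ?thesis by simp
  next
    case False
    have "u \<in> verts G" using u bag_verts[of d t] by (rule subsetD[rotated])
    then obtain n where n: "n \<le> depth u" "narrow d (deep_comp n u)"
      "\<And>x. x \<in> deep_comp n u \<Longrightarrow> same_component (del_verts G S) u x"
      "\<And>w. w \<in> boundary (deep_comp n u) \<Longrightarrow> \<exists>s\<in>S. gdist G w s \<le> enat d"
      by (rule narrow_comp_behind_separator[OF _ diam sep False, of thesis]) (rule that)
    have "v \<in> deep_comp n u \<union> boundary (deep_comp n u)"
      by (rule bag_within_closed_comp[OF t u v n(1,2)])
    then show ?thesis
    proof
      assume "v \<in> deep_comp n u"
      then show ?thesis using n(3) by simp
    next
      assume "v \<in> boundary (deep_comp n u)"
      then obtain s where "s \<in> S" "gdist G v s \<le> enat d" using n(4) by auto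
      then have "set_dist G {v} S \<le> enat d" by (rule set_dist_singleton_le)
      then show ?thesis by simp
    qed
  qed
  have "set_dist G {u} S \<le> enat d \<or> set_dist G {v} S \<le> enat d \<or>
      same_component (del_verts G S) u v"
    if diam: "diam G S \<le> enat d" and u: "u \<in> bag d t" and v: "v \<in> bag d t" for S u v
  proof -
    have "same_component G u v"
      using bag_within_closed_comp[OF t u v, of 0] narrow_comp_0[of d u] boundary_comp_0[of u]
      by (simp add: comp_0)
    then have root: "root v = root u" by (rule root_cong[symmetric])
    let ?H = "del_verts G S"
    show ?thesis
    proof (cases "same_component ?H (root u) u \<and> same_component ?H (root u) v")
      case True
      then have "same_component ?H u v"
        by (elim conjE) (rule same_component_trans[OF same_component_sym])
      then show ?thesis by simp
    next
      case False
      then consider "\<not> same_component ?H (root u) u" | "\<not> same_component ?H (root v) v"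
        using root by auto
      then show ?thesis
      proof cases
        case 1
        then show ?thesis by (rule one_side[OF diam u v])
      next
        case 2
        from one_side[OF diam v u this] show ?thesis
          using same_component_sym[of ?H v u] by argo
      qed
    qed
  qed
  then show ?thesis using bag_verts[of d t] by (simp add: inseparable_def)
qed

end

lemma inseparable_mono:
  assumes "inseparable G d D U" "D \<le> D'" shows "inseparable G d D' U"
proof -
  have le: "k \<le> enat D'" if "k \<le> enat D" for k
    using that by (rule order_trans) (simp add: assms(2))
  show ?thesis
    unfolding inseparable_def
  proof (intro conjI allI impI ballI)
    show "U \<subseteq> verts G" using assms(1) by (simp add: inseparable_def)
    fix S u v
    assume "S \<subseteq> verts G" "diam G S \<le> enat d" "u \<in> U" "v \<in> U"
    then have "set_dist G {u} S \<le> enat D \<or> set_dist G {v} S \<le> enat D \<or>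
        same_component (del_verts G S) u v"
      by (rule assms(1)[unfolded inseparable_def, THEN conjunct2, rule_format])
    then show "set_dist G {u} S \<le> enat D' \<or> set_dist G {v} S \<le> enat D' \<or>
        same_component (del_verts G S) u v"
      by (elim disjE) (simp_all add: le)
  qed
qed

theorem theorem1p1:
  fixes G :: "'a graph" and d :: nat
  assumes "simple_graph G"
  shows "\<exists>(T :: 'a node graph) (B :: 'a node \<Rightarrow> 'a set).
    tree_decomposition G T B \<and>
    (\<forall>s t. {s, t} \<in> edges T \<longrightarrow> diam G (B s \<inter> B t) \<le> enat (5 * d + 2)) \<and>
    (\<forall>t\<in>verts T. inseparable G d (2 * d + 1) (B t))"
proof -
  interpret bfs_layering G by unfold_locales (rule assms)
  let ?T = "prefix_tree (nodes d)" and ?B = "bag d"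
  have adhesion: "diam G (?B s \<inter> ?B t) \<le> enat (5 * d + 2)" if "{s, t} \<in> edges ?T" for s t
    using diam_adhesion_le[OF that] by (rule order_trans) simp
  have insep: "inseparable G d (2 * d + 1) (?B t)" if "t \<in> verts ?T" for t
  proof (rule inseparable_mono)
    show "inseparable G d d (?B t)"
      using that by (intro bag_inseparable) (simp add: prefix_tree_def)
  qed simp
  show ?thesis
    by (intro exI[of _ ?T] exI[of _ ?B] conjI allI impI ballI)
      (fact tree_decomposition_bags adhesion insep)+
qed

end
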